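(* There exists a tropical meromorphic function $f$ such that for every $\delta\in[0,1]$ there exists $a\in\mathbb{R}$ with $\delta(a,f)=\delta$.
   Context: $a\oplus b=\max\{a,b\}$, $1_\circ=0$, $a\oslash b=a-b$, so $1_\circ\oslash(f\oplus a)=-\max\{f,a\}$; $t^+=\max\{t,0\}$. A tropical meromorphic function is a continuous piecewise linear $f:\mathbb{R}\to\mathbb{R}$ (finitely many affine pieces on each bounded interval); with $\omega_f(x)=\lim_{\varepsilon\to0^+}(f'(x+\varepsilon)-f'(x-\varepsilon))$, $x$ is a root if $\omega_f(x)>0$, a pole if $\omega_f(x)<0$, of multiplicity $\tau_f(x)=|\omega_f(x)|$. $m(r,f)=\frac12(f(r)^++f(-r)^+)$, $N(r,f)=\frac12\sum_{|b|<r}\tau_f(b)(r-|b|)$ over the poles $b$ of $f$ in $(-r,r)$, $T(r,f)=m(r,f)+N(r,f)$. The defect is $$\delta(a,f)=1-\limsup_{r\to\infty}\frac{N\big(r,1_\circ\oslash(f\oplus a)\big)}{T(r,f)}.$$ *)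

theory Defs
  imports "HOL-Analysis.Analysis"
begin

definition trop_add :: "real \<Rightarrow> real \<Rightarrow> real"  (infixl "\<oplus>\<^sub>t" 65)
  where "a \<oplus>\<^sub>t b = max a b"

definition trop_one :: real  ("1\<^sub>t")
  where "1\<^sub>t = 0"

definition trop_divide :: "real \<Rightarrow> real \<Rightarrow> real"  (infixl "\<oslash>\<^sub>t" 70)
  where "a \<oslash>\<^sub>t b = a - b"

definition pos_part :: "real \<Rightarrow> real"
  where "pos_part t = max t 0"

text \<open>A division of \<open>{a..b}\<close> is a finite set of compact intervals with disjoint
  interiors whose union is \<open>{a..b}\<close>.\<close>

definition tropical_meromorphic :: "(real \<Rightarrow> real) \<Rightarrow> bool"
  where "tropical_meromorphic f \<longleftrightarrow>
    continuous_on UNIV f \<and>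
    (\<forall>a b. a < b \<longrightarrow>
      (\<exists>P. P division_of {a..b} \<and> (\<forall>K\<in>P. \<exists>m c. \<forall>x\<in>K. f x = m * x + c)))"

definition trop_omega :: "(real \<Rightarrow> real) \<Rightarrow> real \<Rightarrow> real"
  where "trop_omega f x = Lim (at_right 0) (\<lambda>\<epsilon>. deriv f (x + \<epsilon>) - deriv f (x - \<epsilon>))"

definition is_trop_pole :: "(real \<Rightarrow> real) \<Rightarrow> real \<Rightarrow> bool"
  where "is_trop_pole f x \<longleftrightarrow> trop_omega f x < 0"

definition trop_mult :: "(real \<Rightarrow> real) \<Rightarrow> real \<Rightarrow> real"
  where "trop_mult f x = \<bar>trop_omega f x\<bar>"

definition trop_proximity :: "real \<Rightarrow> (real \<Rightarrow> real) \<Rightarrow> real"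
  where "trop_proximity r f = (1 / 2) * (pos_part (f r) + pos_part (f (- r)))"

definition trop_counting :: "real \<Rightarrow> (real \<Rightarrow> real) \<Rightarrow> real"
  where "trop_counting r f =
    (1 / 2) * (\<Sum>b | \<bar>b\<bar> < r \<and> is_trop_pole f b. trop_mult f b * (r - \<bar>b\<bar>))"

definition trop_characteristic :: "real \<Rightarrow> (real \<Rightarrow> real) \<Rightarrow> real"
  where "trop_characteristic r f = trop_proximity r f + trop_counting r f"

text \<open>The upper limit is taken in the extended reals, where it always exists.\<close>

definition trop_defect :: "real \<Rightarrow> (real \<Rightarrow> real) \<Rightarrow> ereal"
  where "trop_defect a f =
    1 - Limsup at_top (\<lambda>r::real.
          ereal (trop_counting r (\<lambda>x. 1\<^sub>t \<oslash>\<^sub>t (f x \<oplus>\<^sub>t a)) / trop_characteristic r f))"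

end

theory Submission
  imports Defs "HOL-Library.Discrete_Functions" "HOL-Real_Asymp.Real_Asymp"
begin

text \<open>
  Let \<open>f\<close> consist of one tent of slopes \<open>1\<close> and \<open>-1\<close> over each positive integer \<open>k\<close>, of height
  \<open>g k / 3\<close>, where the sequence \<open>g\<close> is uniformly distributed in \<open>[0, 1)\<close>. As \<open>f\<close> is bounded,
  \<open>T(r, f)\<close> is \<open>N(r, f)\<close> up to a bounded error, that is \<open>r\<^sup>2 / 2 + o(r\<^sup>2)\<close>. Cutting \<open>f\<close> off at
  the level \<open>a = \<delta> / 3\<close> erases the tents with \<open>g k \<le> \<delta>\<close>, and each remaining one, of mass \<open>2\<close>
  at \<open>k\<close>, contributes two simple poles of \<open>- max f a\<close> symmetric about \<open>k\<close>. Hence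
  \<open>N(r, - max f a) = (1 - \<delta>) r\<^sup>2 / 2 + o(r\<^sup>2)\<close> and the defect of \<open>a\<close> is \<open>\<delta>\<close>.
\<close>

section \<open>One-sided slopes and piecewise linearity\<close>

text \<open>Exact affine germs instead of one-sided derivatives: they add pointwise, force
  continuity at \<open>x\<close> because the value \<open>f x\<close> is built in, and
  \<open>t - s\<close> is the jump measured by \<open>trop_omega\<close>.\<close>

definition slopes_at :: "(real \<Rightarrow> real) \<Rightarrow> real \<Rightarrow> real \<Rightarrow> real \<Rightarrow> bool"
  where "slopes_at f x s t \<longleftrightarrow>
    (\<forall>\<^sub>F y in at_left x. f y = f x + s * (y - x)) \<and>
    (\<forall>\<^sub>F y in at_right x. f y = f x + t * (y - x))"

lemma slopes_at_add:
  assumes "slopes_at f x s t" "slopes_at g x s' t'"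
  shows "slopes_at (\<lambda>y. f y + g y) x (s + s') (t + t')"
proof -
  have "f y + g y = f x + g x + (u + v) * (y - x)"
    if "f y = f x + u * (y - x)" "g y = g x + v * (y - x)" for u v y
    unfolding that by (simp add: algebra_simps)
  then show ?thesis
    using assms unfolding slopes_at_def by (auto elim: eventually_elim2)
qed

lemma slopes_at_cmult:
  assumes "slopes_at f x s t"
  shows "slopes_at (\<lambda>y. c * f y) x (c * s) (c * t)"
proof -
  have "c * f y = c * f x + c * u * (y - x)" if "f y = f x + u * (y - x)" for u y
    unfolding that by (simp add: algebra_simps)
  then show ?thesis
    using assms unfolding slopes_at_def by (auto elim: eventually_mono)
qed

lemma slopes_at_const: "slopes_at (\<lambda>y. c) x 0 0"
  by (simp add: slopes_at_def)

text \<open>The strict test on the left and the weak one on the right differ only at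
  \<open>x = c\<close>, which encodes the kink.\<close>

lemma slopes_at_abs:
  "slopes_at (\<lambda>y. \<bar>y - c\<bar>) x (if x > c then 1 else -1) (if x \<ge> c then 1 else -1)"
proof -
  have "\<forall>\<^sub>F y in at_left x. \<bar>y - c\<bar> = \<bar>x - c\<bar> + (if x > c then 1 else -1) * (y - x)"
  proof (cases "x > c")
    case True
    show ?thesis
      by (rule eventually_at_leftI[of c]) (use True in auto)
  next
    case False
    show ?thesis
      by (rule eventually_at_leftI[of "x - 1"]) (use False in auto)
  qed
  moreover have "\<forall>\<^sub>F y in at_right x. \<bar>y - c\<bar> = \<bar>x - c\<bar> + (if x \<ge> c then 1 else -1) * (y - x)"
  proof (cases "x \<ge> c")
    case True
    show ?thesis
      by (rule eventually_at_rightI[of _ "x + 1"]) (use True in auto)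
  next
    case False
    show ?thesis
      by (rule eventually_at_rightI[of _ c]) (use False in auto)
  qed
  ultimately show ?thesis
    by (simp add: slopes_at_def)
qed

lemma slopes_at_cong:
  assumes "\<forall>\<^sub>F y in nhds x. f y = g y" and "slopes_at g x s t"
  shows "slopes_at f x s t"
proof -
  have "f x = g x"
    using assms(1) by (rule eventually_nhds_x_imp_x)
  moreover have "\<forall>\<^sub>F y in at_left x. f y = g y" "\<forall>\<^sub>F y in at_right x. f y = g y"
    using assms(1) by (auto simp: eventually_at_filter elim: eventually_mono)
  ultimately show ?thesis
    using assms(2) unfolding slopes_at_def by (auto elim: eventually_elim2)
qed

lemma slopes_at_obtain:
  assumes "slopes_at f x s t"
  obtains e where "e > 0"
    "\<And>y. x - e < y \<Longrightarrow> y \<le> x \<Longrightarrow> f y = f x + s * (y - x)"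
    "\<And>y. x \<le> y \<Longrightarrow> y < x + e \<Longrightarrow> f y = f x + t * (y - x)"
proof -
  \<comment> \<open>The rules for one-sided filters ask for some point on the relevant side of
    \<open>x\<close>; choice extracts one from \<open>lt_ex\<close> and
    \<open>gt_ex\<close>.\<close>
  obtain b c where b: "b < x" "\<And>y. b < y \<Longrightarrow> y < x \<Longrightarrow> f y = f x + s * (y - x)"
    and c: "c > x" "\<And>y. x < y \<Longrightarrow> y < c \<Longrightarrow> f y = f x + t * (y - x)"
    using assms unfolding slopes_at_def
      eventually_at_left[OF lt_ex[THEN someI_ex]] eventually_at_right[OF gt_ex[THEN someI_ex]]
    by blast
  show thesis
  proof (rule that[of "min (x - b) (c - x)"])
    show "min (x - b) (c - x) > 0" using b(1) c(1) by simp
    show "f y = f x + s * (y - x)" if "x - min (x - b) (c - x) < y" "y \<le> x" for y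
      using b(2)[of y] that by (cases "y = x") auto
    show "f y = f x + t * (y - x)" if "x \<le> y" "y < x + min (x - b) (c - x)" for y
      using c(2)[of y] that by (cases "y = x") auto
  qed
qed

text \<open>On each side the derivative is constant near \<open>x\<close>, so the difference
  defining \<open>trop_omega\<close> is eventually constant.\<close>

lemma trop_omega_slopes_at:
  assumes "slopes_at f x s t"
  shows "trop_omega f x = t - s"
proof -
  obtain e where e: "e > 0"
    "\<And>y. x - e < y \<Longrightarrow> y \<le> x \<Longrightarrow> f y = f x + s * (y - x)"
    "\<And>y. x \<le> y \<Longrightarrow> y < x + e \<Longrightarrow> f y = f x + t * (y - x)"
    using slopes_at_obtain[OF assms] by metis
  have "deriv f y = t" if "x < y" "y < x + e" for y
  proof (rule DERIV_imp_deriv)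
    have "((\<lambda>y. f x + t * (y - x)) has_real_derivative t) (at y)"
      by (auto intro!: derivative_eq_intros)
    then show "(f has_real_derivative t) (at y)"
      by (rule has_field_derivative_transform_within_open[of _ _ _ "{x<..<x + e}"])
        (use that in \<open>auto intro!: e(3)[symmetric]\<close>)
  qed
  moreover have "deriv f y = s" if "x - e < y" "y < x" for y
  proof (rule DERIV_imp_deriv)
    have "((\<lambda>y. f x + s * (y - x)) has_real_derivative s) (at y)"
      by (auto intro!: derivative_eq_intros)
    then show "(f has_real_derivative s) (at y)"
      by (rule has_field_derivative_transform_within_open[of _ _ _ "{x - e<..<x}"])
        (use that in \<open>auto intro!: e(2)[symmetric]\<close>)
  qed
  ultimately have "\<forall>\<^sub>F \<epsilon> in at_right 0. deriv f (x + \<epsilon>) - deriv f (x - \<epsilon>) = t - s"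
    by (intro eventually_at_rightI[of _ e]) (use e(1) in auto)
  then have "((\<lambda>\<epsilon>. deriv f (x + \<epsilon>) - deriv f (x - \<epsilon>)) \<longlongrightarrow> t - s) (at_right 0)"
    by (rule tendsto_eventually)
  then show ?thesis
    unfolding trop_omega_def by (intro tendsto_Lim) auto
qed

text \<open>Having a finite affine division passes to unions of adjacent intervals and holds for all
  short intervals around a given point. The bisection principle \<open>Bolzano\<close> extends it to
  every compact interval.\<close>

lemma tropical_meromorphic_slopes_at:
  assumes "\<And>x. \<exists>s t. slopes_at f x s t"
  shows "tropical_meromorphic f"
proof -
  let ?aff = "\<lambda>a b. \<exists>P. P division_of {a..b} \<and> (\<forall>K\<in>P. \<exists>m c. \<forall>x\<in>K. f x = m * x + c)"
  have aff: "?aff a b" if "a \<le> b" "\<And>y. y \<in> {a..b} \<Longrightarrow> f y = f x + m * (y - x)" for a b m x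
  proof -
    have "{{a..b}} division_of {a..b}"
      using division_of_self[of a b] that(1) by auto
    moreover have "\<forall>y\<in>{a..b}. f y = m * y + (f x - m * x)"
      using that(2) by (simp add: algebra_simps)
    ultimately show ?thesis by blast
  qed
  have join: "?aff a c" if *: "?aff a b" "?aff b c" and "a \<le> b" "b \<le> c" for a b c
  proof -
    obtain P Q where "P division_of {a..b}" "\<forall>K\<in>P. \<exists>m c. \<forall>x\<in>K. f x = m * x + c"
      "Q division_of {b..c}" "\<forall>K\<in>Q. \<exists>m c. \<forall>x\<in>K. f x = m * x + c"
      using * by blast
    moreover from this have "P \<union> Q division_of {a..b} \<union> {b..c}"
      by (intro division_disjoint_union) auto
    moreover have "{a..b} \<union> {b..c} = {a..c}"
      using that by auto
    ultimately show ?thesis by (intro exI[of _ "P \<union> Q"]) auto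
  qed
  have "?aff a b" if "a < b" for a b
  proof (rule Bolzano)
    show "a \<le> b" using that by simp
    show "?aff a c" if "?aff a b" "?aff b c" "a \<le> b" "b \<le> c" for a b c
      by (rule join) (fact that)+
    fix x
    obtain s t where "slopes_at f x s t" using assms by blast
    then obtain e where e: "e > 0"
      "\<And>y. x - e < y \<Longrightarrow> y \<le> x \<Longrightarrow> f y = f x + s * (y - x)"
      "\<And>y. x \<le> y \<Longrightarrow> y < x + e \<Longrightarrow> f y = f x + t * (y - x)"
      using slopes_at_obtain by metis
    have "?aff a b" if "a \<le> x" "x \<le> b" "b - a < e" for a b
    proof (rule join[of _ x])
      show "?aff a x" by (rule aff[of _ _ x s]) (use that in \<open>auto intro!: e(2)\<close>)
      show "?aff x b" by (rule aff[of _ _ x t]) (use that in \<open>auto intro!: e(3)\<close>)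
    qed (use that in auto)
    then show "\<exists>d>0. \<forall>a b. a \<le> x \<and> x \<le> b \<and> b - a < d \<longrightarrow> ?aff a b"
      using e(1) by blast
  qed
  moreover have "isCont f x" for x
  proof -
    obtain s t where st: "slopes_at f x s t" using assms by blast
    have "((\<lambda>y. f x + s * (y - x)) \<longlongrightarrow> f x) (at_left x)"
      by (auto intro!: tendsto_eq_intros)
    then have "(f \<longlongrightarrow> f x) (at_left x)"
      using st unfolding slopes_at_def
      by (auto elim!: Lim_transform_eventually eventually_mono)
    moreover have "((\<lambda>y. f x + t * (y - x)) \<longlongrightarrow> f x) (at_right x)"
      by (auto intro!: tendsto_eq_intros)
    then have "(f \<longlongrightarrow> f x) (at_right x)"
      using st unfolding slopes_at_def
      by (auto elim!: Lim_transform_eventually eventually_mono)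
    ultimately show ?thesis
      by (simp add: isCont_def filterlim_split_at)
  qed
  then have "continuous_on UNIV f"
    by (simp add: continuous_at_imp_continuous_on)
  ultimately show ?thesis
    unfolding tropical_meromorphic_def by blast
qed

section \<open>Separated tents and the poles they produce\<close>

definition tent :: "real \<Rightarrow> real \<Rightarrow> real"
  where "tent H u = max 0 (H - \<bar>u\<bar>)"

lemma tent_0 [simp]: "tent 0 u = 0"
  by (simp add: tent_def)

text \<open>Half the second difference of the absolute value with step \<open>H\<close>, in a form
  to which the slope rules apply.\<close>

lemma tent_abs:
  assumes "H \<ge> 0"
  shows "tent H u = 1 / 2 * \<bar>u - H\<bar> + (1 / 2 * \<bar>u - (-H)\<bar> + (-1) * \<bar>u - 0\<bar>)"
  using assms unfolding tent_def
  by (cases "u \<ge> 0"; cases "u \<le> H"; cases "- u \<le> H"; simp add: max_def field_simps)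

lemma tent_nonneg: "tent H u \<ge> 0"
  by (simp add: tent_def)

lemma tent_le:
  assumes "0 \<le> H" "H \<le> c"
  shows "tent H u \<le> c"
  using assms by (auto simp: tent_def max_def abs_if)

text \<open>A truncated tent is a lower tent on a raised base, so the family is closed under cutting
  off, up to a constant.\<close>

lemma max_tent:
  assumes "a \<ge> 0" "H \<ge> 0"
  shows "max (tent H u) a = a + tent (max 0 (H - a)) u"
  using assms by (auto simp: tent_def max_def abs_if)

text \<open>Since \<open>nat\<close> sends negative integers to \<open>0\<close>, the condition \<open>h 0 = 0\<close>
  removes all tents outside the positive integers.\<close>

definition tents :: "(nat \<Rightarrow> real) \<Rightarrow> real \<Rightarrow> real"
  where "tents h x = tent (h (nat (round x))) (x - round x)"

text \<open>The bound \<open>1 / 3\<close> keeps the tents apart: peak and feet of the tent over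
  \<open>k\<close> lie within \<open>1 / 2\<close> of \<open>k\<close>, so \<open>round\<close>
  recovers \<open>k\<close> from them.\<close>

locale tent_heights =
  fixes h :: "nat \<Rightarrow> real"
  assumes h_zero: "h 0 = 0" and h_nonneg: "h k \<ge> 0" and h_le: "h k \<le> 1 / 3"
begin

text \<open>The radius exceeds \<open>1 / 2\<close> so that half-integers, too, have a neighbourhood
  with a single formula. If \<open>round x\<close> is not \<open>n\<close>, then \<open>x\<close> is
  at least \<open>1 / 3\<close> away from both centres and both tents vanish there.\<close>

lemma tents_local:
  assumes "\<bar>x - of_int n\<bar> < 2 / 3"
  shows "tents h x = tent (h (nat n)) (x - of_int n)"
proof (cases "round x = n")
  case False
  have "\<bar>x - of_int (round x)\<bar> \<le> 1 / 2"
    using of_int_round_abs_le[of x] by (simp add: abs_minus_commute)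
  moreover have "\<bar>real_of_int (round x) - of_int n\<bar> \<ge> 1"
    using False by linarith
  ultimately have "\<bar>x - of_int (round x)\<bar> \<ge> 1 / 3" "\<bar>x - of_int n\<bar> \<ge> 1 / 3"
    using assms by linarith+
  then show ?thesis
    using h_le[of "nat n"] h_le[of "nat (round x)"] unfolding tents_def tent_def by linarith
qed (simp add: tents_def)

lemma tents_nonneg: "tents h x \<ge> 0"
  and tents_le: "tents h x \<le> 1 / 3"
  using h_nonneg h_le by (simp_all only: tents_def tent_nonneg tent_le)

lemma tents_nonpos:
  assumes "x \<le> 0"
  shows "tents h x = 0"
proof -
  have "round x \<le> 0"
    using round_mono[OF assms] by simp
  then show ?thesis
    by (simp add: tents_def h_zero)
qed

text \<open>By \<open>tent_abs\<close> each absolute value contributes one indicator to the jump.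
  For \<open>H = 0\<close> the three cancel, so tents of height zero need no separate
  treatment.\<close>

lemma slopes_at_tents:
  fixes x :: real
  defines "n \<equiv> real_of_int (round x)" and "H \<equiv> h (nat (round x))"
  shows "\<exists>s t. slopes_at (tents h) x s t \<and>
    t - s = of_bool (x - n = H) + of_bool (x - n = - H) - 2 * of_bool (x = n)"
proof -
  have "slopes_at (\<lambda>y. 1 / 2 * \<bar>y - (n + H)\<bar> + (1 / 2 * \<bar>y - (n - H)\<bar> + (-1) * \<bar>y - n\<bar>)) x
      (1 / 2 * (if x > n + H then 1 else -1) +
        (1 / 2 * (if x > n - H then 1 else -1) + (-1) * (if x > n then 1 else -1)))
      (1 / 2 * (if x \<ge> n + H then 1 else -1) +
        (1 / 2 * (if x \<ge> n - H then 1 else -1) + (-1) * (if x \<ge> n then 1 else -1)))"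
    (is "slopes_at ?g x ?s ?t")
    by (intro slopes_at_add slopes_at_cmult slopes_at_abs)
  moreover have "\<forall>\<^sub>F y in nhds x. tents h y = ?g y"
  proof -
    have "\<forall>\<^sub>F y in nhds x. y \<in> ball n (2 / 3)"
      using of_int_round_abs_le[of x] by (intro eventually_nhds_in_open) (auto simp: n_def dist_real_def)
    then show ?thesis
    proof eventually_elim
      case (elim y)
      then have "tents h y = tent H (y - n)"
        using tents_local[of y "round x"] by (simp add: n_def H_def dist_real_def abs_minus_commute)
      also have "\<dots> = ?g y"
        using tent_abs[of H "y - n"] h_nonneg by (simp add: H_def algebra_simps)
      finally show ?case .
    qed
  qed
  ultimately have "slopes_at (tents h) x ?s ?t"
    by (rule slopes_at_cong[rotated])
  moreover have "?t - ?s = of_bool (x - n = H) + of_bool (x - n = - H) - 2 * of_bool (x = n)"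
    using h_nonneg[of "nat (round x)", folded H_def] by (auto simp: field_simps split: if_splits)
  ultimately show ?thesis by blast
qed

lemma tropical_meromorphic_tents: "tropical_meromorphic (tents h)"
  using slopes_at_tents by (intro tropical_meromorphic_slopes_at) blast

lemma trop_omega_tents:
  "trop_omega (tents h) x = of_bool (x - round x = h (nat (round x))) +
    of_bool (x - round x = - h (nat (round x))) - 2 * of_bool (x = round x)"
  using slopes_at_tents[of x] trop_omega_slopes_at by metis

lemma trop_omega_minus_tents:
  "trop_omega (\<lambda>y. - a - tents h y) x = - trop_omega (tents h) x"
proof -
  obtain s t where st: "slopes_at (tents h) x s t"
    using slopes_at_tents by blast
  have "slopes_at (\<lambda>y. - a + (- 1) * tents h y) x (0 + (- 1) * s) (0 + (- 1) * t)"
    by (rule slopes_at_add[OF slopes_at_const slopes_at_cmult[OF st]])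
  from trop_omega_slopes_at[OF this] trop_omega_slopes_at[OF st] show ?thesis
    by simp
qed

lemma round_near:
  assumes "\<bar>u\<bar> \<le> 1 / 3"
  shows "round (real k + u) = int k"
  by (rule round_unique) (use assms in linarith)+

text \<open>Only peaks bend downwards, and a peak of height \<open>0\<close> is cancelled by its own
  feet.\<close>

lemma is_trop_pole_tents: "is_trop_pole (tents h) x \<longleftrightarrow> (\<exists>k. x = real k \<and> h k > 0)"
proof
  assume "is_trop_pole (tents h) x"
  then have neg: "trop_omega (tents h) x < 0" by (simp add: is_trop_pole_def)
  then have x: "x = round x" by (auto simp: trop_omega_tents of_bool_def split: if_splits)
  with neg have "h (nat (round x)) \<noteq> 0" by (auto simp: trop_omega_tents)
  \<comment> \<open>\<open>nat\<close> collapses nonpositive centres to the index \<open>0\<close>,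
    where the height is zero.\<close>
  moreover from this have "round x > 0"
    using h_zero by (metis nat_0_iff not_le)
  ultimately show "\<exists>k. x = real k \<and> h k > 0"
    using x h_nonneg[of "nat (round x)"] by (intro exI[of _ "nat (round x)"]) auto
qed (auto simp: is_trop_pole_def trop_omega_tents)

text \<open>Negation turns the upward kinks at the two feet into poles.\<close>

lemma is_trop_pole_minus_tents:
  "is_trop_pole (\<lambda>y. - a - tents h y) x \<longleftrightarrow>
    (\<exists>k. h k > 0 \<and> (x = real k + h k \<or> x = real k - h k))"
proof
  assume "is_trop_pole (\<lambda>y. - a - tents h y) x"
  then have pos: "trop_omega (tents h) x > 0"
    by (simp add: is_trop_pole_def trop_omega_minus_tents)
  then have x: "x \<noteq> round x"
    by (auto simp: trop_omega_tents of_bool_def split: if_splits)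
  from pos have *: "x - round x = h (nat (round x)) \<or> x - round x = - h (nat (round x))"
    by (auto simp: trop_omega_tents of_bool_def split: if_splits)
  with x have "h (nat (round x)) \<noteq> 0" by auto
  moreover from this have "round x > 0"
    using h_zero by (metis nat_0_iff not_le)
  ultimately show "\<exists>k. h k > 0 \<and> (x = real k + h k \<or> x = real k - h k)"
    using * h_nonneg[of "nat (round x)"] by (intro exI[of _ "nat (round x)"]) auto
next
  assume "\<exists>k. h k > 0 \<and> (x = real k + h k \<or> x = real k - h k)"
  then obtain k where "h k > 0" "x = real k + h k \<or> x = real k - h k" by blast
  moreover from this have "round x = int k"
    using round_near[of "h k" k] round_near[of "- h k" k] h_nonneg[of k] h_le[of k] by auto
  ultimately show "is_trop_pole (\<lambda>y. - a - tents h y) x"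
    by (auto simp: is_trop_pole_def trop_omega_minus_tents trop_omega_tents)
qed

text \<open>Each peak has multiplicity \<open>2\<close>, which cancels the factor
  \<open>1 / 2\<close> in \<open>trop_counting\<close>.\<close>

lemma trop_counting_tents:
  "trop_counting r (tents h) = (\<Sum>k | h k > 0 \<and> real k < r. r - real k)"
proof -
  have "{b. \<bar>b\<bar> < r \<and> is_trop_pole (tents h) b} = real ` {k. h k > 0 \<and> real k < r}"
    by (auto simp: is_trop_pole_tents)
  then have "(\<Sum>b | \<bar>b\<bar> < r \<and> is_trop_pole (tents h) b. trop_mult (tents h) b * (r - \<bar>b\<bar>)) =
      (\<Sum>k | h k > 0 \<and> real k < r. trop_mult (tents h) k * (r - \<bar>real k\<bar>))"
    by (simp add: sum.reindex)
  also have "\<dots> = (\<Sum>k | h k > 0 \<and> real k < r. 2 * (r - real k))"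
    by (intro sum.cong) (auto simp: trop_mult_def trop_omega_tents)
  also have "\<dots> = 2 * (\<Sum>k | h k > 0 \<and> real k < r. r - real k)"
    by (rule sum_distrib_left[symmetric])
  finally show ?thesis
    by (simp add: trop_counting_def)
qed

text \<open>The simple poles at \<open>k - h k\<close> and \<open>k + h k\<close> together weigh as
  much as a double pole at \<open>k\<close>, unless \<open>r\<close> lies between them. Bounding
  every deviation by \<open>1 / 3\<close> costs a linear error, negligible against quadratic
  growth.\<close>

lemma trop_counting_minus_tents:
  assumes "r > 0"
  shows "\<bar>trop_counting r (\<lambda>y. - a - tents h y) - (\<Sum>k | h k > 0 \<and> real k < r. r - real k)\<bar>
    \<le> r + 2"
proof -
  let ?g = "\<lambda>y. - a - tents h y"
  \<comment> \<open>Up to \<open>r + 1\<close> rather than \<open>r\<close>, because a left foot can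
    lie below \<open>r\<close> when its centre does not.\<close>
  define K where "K = {k. h k > 0 \<and> real k < r + 1}"
  have K_sub: "K \<subseteq> {..nat \<lceil>r + 1\<rceil>}"
    by (auto simp: K_def) linarith
  then have fin: "finite K" by (rule finite_subset) simp
  \<comment> \<open>Clipping at \<open>0\<close> annuls the poles beyond \<open>r\<close>, so the
    sums may run over all of \<open>K\<close>.\<close>
  define F where "F = (\<lambda>b. max 0 (r - b))"
  have pos: "real k - h k > 0" if "h k > 0" for k
    using that h_le[of k] h_zero by (cases k) auto
  define A B where "A = (\<lambda>k. real k + h k) ` K" and "B = (\<lambda>k. real k - h k) ` K"
  have r1: "round (real k + h k) = int k" and r2: "round (real k - h k) = int k" for k
    using round_near[of "h k" k] round_near[of "- h k" k] h_nonneg[of k] h_le[of k] by auto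
  have injA: "inj_on (\<lambda>k. real k + h k) K"
    by (rule inj_on_inverseI[of _ "\<lambda>x. nat (round x)"]) (simp add: r1)
  have injB: "inj_on (\<lambda>k. real k - h k) K"
    by (rule inj_on_inverseI[of _ "\<lambda>x. nat (round x)"]) (simp add: r2)
  have disj: "A \<inter> B = {}"
  proof -
    have False if "k \<in> K" "real k + h k = real l - h l" "l \<in> K" for k l
    proof -
      have "k = l" using r1[of k] r2[of l] that by simp
      then show False using that by (auto simp: K_def)
    qed
    then show ?thesis by (auto simp: A_def B_def)
  qed
  have "(\<Sum>b | \<bar>b\<bar> < r \<and> is_trop_pole ?g b. trop_mult ?g b * (r - \<bar>b\<bar>)) = (\<Sum>b\<in>A \<union> B. F b)"
  proof (rule sum.mono_neutral_cong_left)
    show "finite (A \<union> B)" using fin by (simp add: A_def B_def)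
    show "{b. \<bar>b\<bar> < r \<and> is_trop_pole ?g b} \<subseteq> A \<union> B"
    proof
      fix b assume "b \<in> {b. \<bar>b\<bar> < r \<and> is_trop_pole ?g b}"
      then have b: "\<bar>b\<bar> < r" and "is_trop_pole ?g b" by simp_all
      then obtain k where k: "h k > 0" "b = real k + h k \<or> b = real k - h k"
        unfolding is_trop_pole_minus_tents by blast
      then have "k \<in> K" using b h_le[of k] by (auto simp: K_def)
      then show "b \<in> A \<union> B" using k by (auto simp: A_def B_def)
    qed
    have AB: "is_trop_pole ?g b \<and> b > 0" if b: "b \<in> A \<union> B" for b
    proof -
      obtain k where k: "h k > 0" "b = real k + h k \<or> b = real k - h k"
        using b by (auto simp: A_def B_def K_def)
      then have "b > 0" using pos[of k] by auto
      with k show ?thesis by (auto simp: is_trop_pole_minus_tents)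
    qed
    then show "\<forall>b\<in>A \<union> B - {b. \<bar>b\<bar> < r \<and> is_trop_pole ?g b}. F b = 0"
      by (fastforce simp: F_def)
    fix b assume b: "b \<in> {b. \<bar>b\<bar> < r \<and> is_trop_pole ?g b}"
    then have "is_trop_pole ?g b" by simp
    then obtain k where k: "h k > 0" "b = real k + h k \<or> b = real k - h k"
      unfolding is_trop_pole_minus_tents by blast
    then have "round b = int k" using r1 r2 by auto
    with k have "trop_mult ?g b = 1"
      by (auto simp: trop_mult_def trop_omega_minus_tents trop_omega_tents)
    moreover have "b > 0" using pos[of k] k by auto
    ultimately show "trop_mult ?g b * (r - \<bar>b\<bar>) = F b"
      using b by (simp add: F_def)
  qed
  also have "\<dots> = (\<Sum>k\<in>K. F (real k + h k)) + (\<Sum>k\<in>K. F (real k - h k))"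
    using fin disj injA injB
    by (simp add: sum.union_disjoint A_def B_def sum.reindex)
  also have "\<dots> = 2 * (\<Sum>k\<in>K. F (real k)) + (\<Sum>k\<in>K. tent (h k) (r - real k))"
  proof -
    \<comment> \<open>The second difference of the positive part is a tent.\<close>
    have "F (real k + h k) + F (real k - h k) = 2 * F (real k) + tent (h k) (r - real k)" for k
      using h_nonneg[of k] unfolding F_def tent_def max_def abs_if by auto
    then show ?thesis
      by (simp add: sum.distrib[symmetric] sum_distrib_left)
  qed
  also have "(\<Sum>k\<in>K. F (real k)) = (\<Sum>k | h k > 0 \<and> real k < r. r - real k)"
    using fin by (intro sum.mono_neutral_cong_right) (auto simp: K_def F_def)
  finally have eq: "trop_counting r ?g - (\<Sum>k | h k > 0 \<and> real k < r. r - real k) =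
      1 / 2 * (\<Sum>k\<in>K. tent (h k) (r - real k))"
    unfolding trop_counting_def by linarith
  have "(\<Sum>k\<in>K. tent (h k) (r - real k)) \<le> (\<Sum>k\<in>K. 1 / 3)"
  proof (rule sum_mono)
    show "tent (h k) (r - real k) \<le> 1 / 3" for k
      using h_nonneg h_le by (rule tent_le)
  qed
  also have "\<dots> \<le> 1 / 3 * (r + 3)"
  proof -
    have "card K \<le> nat \<lceil>r + 1\<rceil> + 1"
      using card_mono[OF _ K_sub] by simp
    also have "real \<dots> \<le> r + 3"
      using assms by simp linarith
    finally show ?thesis by simp
  qed
  finally have "(\<Sum>k\<in>K. tent (h k) (r - real k)) \<le> 1 / 3 * (r + 3)" .
  moreover have "(\<Sum>k\<in>K. tent (h k) (r - real k)) \<ge> 0"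
    by (intro sum_nonneg tent_nonneg)
  ultimately show ?thesis
    unfolding eq using assms by simp
qed

lemma max_tents:
  assumes "a \<ge> 0"
  shows "max (tents h x) a = a + tents (\<lambda>k. max 0 (h k - a)) x"
  unfolding tents_def by (rule max_tent[OF assms h_nonneg])

end

section \<open>Abel summation and a uniformly distributed sequence\<close>

text \<open>Summation by parts as an induction: with the boundary term kept on the left, the bounds
  \<open>B * (w M - w (Suc M))\<close> telescope.\<close>

lemma abel_sum_bound:
  fixes e w :: "nat \<Rightarrow> real"
  assumes "\<And>k. w (Suc k) \<le> w k" and "\<And>j. j \<le> M \<Longrightarrow> \<bar>\<Sum>k<j. e k\<bar> \<le> B"
  shows "\<bar>(\<Sum>k<M. e k * w k) - (\<Sum>k<M. e k) * w M\<bar> \<le> B * (w 0 - w M)"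
  using assms(2)
proof (induction M)
  case (Suc M)
  have "(\<Sum>k<Suc M. e k * w k) - (\<Sum>k<Suc M. e k) * w (Suc M) =
      ((\<Sum>k<M. e k * w k) - (\<Sum>k<M. e k) * w M) + (\<Sum>k<Suc M. e k) * (w M - w (Suc M))"
    by (simp add: algebra_simps)
  moreover have "\<bar>(\<Sum>k<M. e k * w k) - (\<Sum>k<M. e k) * w M\<bar> \<le> B * (w 0 - w M)"
    using Suc by simp
  moreover have "\<bar>(\<Sum>k<Suc M. e k) * (w M - w (Suc M))\<bar> \<le> B * (w M - w (Suc M))"
    unfolding abs_mult using assms(1)[of M] Suc.prems[of "Suc M"]
    by (simp add: mult_right_mono del: sum.lessThan_Suc)
  ultimately show ?case
    by (simp add: algebra_simps)
qed auto

text \<open>On the block from \<open>m\<^sup>2\<close> to \<open>(m + 1)\<^sup>2 - 1\<close> the values are \<open>j / (2 m + 1)\<close> for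
  \<open>j = 0, \<dots>, 2 m\<close>, so each completed block adds at most \<open>1\<close> to the discrepancy.\<close>

definition square_frac :: "nat \<Rightarrow> real"
  where "square_frac k = (real k - (floor_sqrt k)\<^sup>2) / (2 * floor_sqrt k + 1)"

lemma square_frac_bounds: "square_frac k \<ge> 0" "square_frac k < 1"
proof -
  have "(floor_sqrt k)\<^sup>2 \<le> k" "k < (Suc (floor_sqrt k))\<^sup>2"
    using floor_sqrt_power2_le Suc_floor_sqrt_power2_gt by auto
  then have "real ((floor_sqrt k)\<^sup>2) \<le> real k" "real k < real ((Suc (floor_sqrt k))\<^sup>2)"
    by (simp_all only: of_nat_le_iff of_nat_less_iff)
  then show "square_frac k \<ge> 0" "square_frac k < 1"
    by (simp_all add: square_frac_def power2_eq_square algebra_simps)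
qed

lemma square_frac_add:
  assumes "j \<le> 2 * m"
  shows "square_frac (m\<^sup>2 + j) = real j / real (2 * m + 1)"
proof -
  have "floor_sqrt (m\<^sup>2 + j) = m"
    by (rule floor_sqrt_unique) (use assms in \<open>auto simp: power2_eq_square\<close>)
  then show ?thesis
    by (simp add: square_frac_def)
qed

text \<open>The block has \<open>n = 2 * m + 1\<close> equally spaced values; those above
  \<open>\<delta>\<close> number \<open>n - 1 - \<lfloor>\<delta> * n\<rfloor>\<close> when
  \<open>\<delta> < 1\<close>, which is within \<open>1\<close> of
  \<open>(1 - \<delta>) * n\<close>.\<close>

lemma square_frac_block:
  assumes "\<delta> \<in> {0..1}"
  shows "\<bar>\<Sum>k\<in>{m\<^sup>2..<(Suc m)\<^sup>2}. of_bool (square_frac k > \<delta>) - (1 - \<delta>)\<bar> \<le> 1"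
proof -
  define n where "n = 2 * m + 1"
  have n: "(Suc m)\<^sup>2 = n + m\<^sup>2" "n > 0"
    by (simp_all add: n_def power2_eq_square)
  have "(\<Sum>k\<in>{m\<^sup>2..<(Suc m)\<^sup>2}. of_bool (square_frac k > \<delta>) - (1 - \<delta>)) =
      (\<Sum>j<n. of_bool (square_frac (m\<^sup>2 + j) > \<delta>) - (1 - \<delta>))"
    using sum.shift_bounds_nat_ivl[of "\<lambda>k. of_bool (square_frac k > \<delta>) - (1 - \<delta>)" 0 "m\<^sup>2" n]
    by (simp add: n(1) atLeast0LessThan add.commute)
  also have "\<dots> = (\<Sum>j<n. of_bool (real j > \<delta> * n) - (1 - \<delta>))"
  proof (intro sum.cong refl)
    fix j assume "j \<in> {..<n}"
    then have sq: "square_frac (m\<^sup>2 + j) = real j / real n"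
      unfolding n_def by (intro square_frac_add) auto
    show "of_bool (square_frac (m\<^sup>2 + j) > \<delta>) - (1 - \<delta>) =
        of_bool (real j > \<delta> * n) - (1 - \<delta>)"
      unfolding sq using n(2) by (simp add: pos_less_divide_eq)
  qed
  also have "\<dots> = real (card {j\<in>{..<n}. real j > \<delta> * n}) - (1 - \<delta>) * n"
    by (simp add: sum_subtractf Int_def mult.commute)
  also have "{j\<in>{..<n}. real j > \<delta> * n} = {nat \<lfloor>\<delta> * n\<rfloor> + 1..<n}"
  proof -
    have "\<delta> * n \<ge> 0" using assms by simp
    then show ?thesis by (auto; linarith)
  qed
  \<comment> \<open>For \<open>\<delta> = 1\<close> truncated subtraction gives \<open>0\<close>,
    the correct count.\<close>
  finally have eq: "(\<Sum>k\<in>{m\<^sup>2..<(Suc m)\<^sup>2}. of_bool (square_frac k > \<delta>) - (1 - \<delta>)) =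
    real (n - (nat \<lfloor>\<delta> * n\<rfloor> + 1)) - (1 - \<delta>) * n" by simp
  have "\<delta> * n \<ge> 0" "\<delta> * n \<le> n"
    using assms by (auto simp: mult_left_le_one_le)
  then show ?thesis
    unfolding eq by (simp add: algebra_simps) linarith
qed

text \<open>The completed blocks below \<open>m\<^sup>2\<close> contribute at most \<open>m\<close>
  in total; the unfinished one has at most \<open>2 * m\<close> terms, each of size at most
  \<open>1\<close>.\<close>

lemma square_frac_discrepancy:
  assumes "\<delta> \<in> {0..1}"
  shows "\<bar>\<Sum>k<n. of_bool (square_frac k > \<delta>) - (1 - \<delta>)\<bar> \<le> 3 * sqrt n"
proof -
  let ?e = "\<lambda>k. of_bool (square_frac k > \<delta>) - (1 - \<delta>)"
  have sq: "\<bar>\<Sum>k<m\<^sup>2. ?e k\<bar> \<le> real m" for m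
  proof (induction m)
    case (Suc m)
    have "(\<Sum>k<(Suc m)\<^sup>2. ?e k) = (\<Sum>k<m\<^sup>2. ?e k) + (\<Sum>k\<in>{m\<^sup>2..<(Suc m)\<^sup>2}. ?e k)"
      unfolding atLeast0LessThan[symmetric] by (rule sum.atLeastLessThan_concat[symmetric]) auto
    then show ?case
      using Suc square_frac_block[OF assms, of m] by simp
  qed simp
  define m where "m = floor_sqrt n"
  have m: "m\<^sup>2 \<le> n" "n \<le> m\<^sup>2 + 2 * m"
    using floor_sqrt_power2_le[of n] Suc_floor_sqrt_power2_gt[of n]
    by (auto simp: m_def power2_eq_square)
  have "(\<Sum>k<n. ?e k) = (\<Sum>k<m\<^sup>2. ?e k) + (\<Sum>k\<in>{m\<^sup>2..<n}. ?e k)"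
    unfolding atLeast0LessThan[symmetric] by (rule sum.atLeastLessThan_concat[symmetric]) (use m in auto)
  moreover have "\<bar>\<Sum>k\<in>{m\<^sup>2..<n}. ?e k\<bar> \<le> (\<Sum>k\<in>{m\<^sup>2..<n}. 1)"
    by (rule order_trans[OF sum_abs sum_mono]) (use assms in auto)
  moreover have "(\<Sum>k\<in>{m\<^sup>2..<n}. 1) \<le> 2 * real m"
  proof -
    have "real n \<le> real (m\<^sup>2 + 2 * m)"
      using m(2) by (simp only: of_nat_le_iff)
    then show ?thesis using m(1) by simp
  qed
  moreover have "real m \<le> sqrt n"
    using m(1) by (intro real_le_rsqrt) (metis of_nat_le_iff of_nat_power)
  ultimately show ?thesis
    using sq[of m] by linarith
qed

text \<open>Abel summation against the weights \<open>r - k\<close> turns a discrepancy of order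
  \<open>sqrt r\<close> into an error of order \<open>r * sqrt r\<close>; the main term is
  \<open>1 - \<delta>\<close> times the sum of the weights.\<close>

lemma square_frac_riesz_mean:
  assumes "\<delta> \<in> {0..1}"
  shows "((\<lambda>r. (\<Sum>k | square_frac k > \<delta> \<and> real k < r. r - real k) / r\<^sup>2) \<longlongrightarrow> (1 - \<delta>) / 2) at_top"
proof -
  let ?S = "\<lambda>r. \<Sum>k | square_frac k > \<delta> \<and> real k < r. r - real k"
  have bound: "\<bar>?S r / r\<^sup>2 - (1 - \<delta>) / 2\<bar> \<le> (3 * sqrt (r + 1) * r + (r + 1) / 2) / r\<^sup>2" if r: "r > 0" for r
  proof -
    \<comment> \<open>Rounding up puts every \<open>k < r\<close> below \<open>M\<close> and makes
      \<open>w M = 0\<close>, which removes the boundary term of the Abel summation.\<close>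
    define M where "M = nat \<lceil>r\<rceil>"
    have M: "r \<le> real M" "real M < r + 1"
      using r by (auto simp: M_def) linarith
    define w where "w = (\<lambda>k::nat. max 0 (r - real k))"
    let ?e = "\<lambda>k. of_bool (square_frac k > \<delta>) - (1 - \<delta>)"
    have "\<bar>(\<Sum>k<M. ?e k * w k) - (\<Sum>k<M. ?e k) * w M\<bar> \<le> 3 * sqrt (r + 1) * (w 0 - w M)"
    proof (rule abel_sum_bound)
      fix j assume "j \<le> M"
      then have "sqrt j \<le> sqrt (r + 1)" using M by simp
      then show "\<bar>\<Sum>k<j. ?e k\<bar> \<le> 3 * sqrt (r + 1)"
        using square_frac_discrepancy[OF assms, of j] by linarith
    qed (auto simp: w_def)
    then have 1: "\<bar>\<Sum>k<M. ?e k * w k\<bar> \<le> 3 * sqrt (r + 1) * r"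
      using M r by (simp add: w_def)
    have "(\<Sum>k<M. of_bool (square_frac k > \<delta>) * w k) = ?S r"
      using M(1) by (intro sum.mono_neutral_cong_right) (auto simp: w_def)
    then have 2: "(\<Sum>k<M. ?e k * w k) = ?S r - (1 - \<delta>) * (\<Sum>k<M. w k)"
      by (simp add: left_diff_distrib sum_subtractf sum_distrib_left)
    have "(\<Sum>k<M. w k) = (\<Sum>k<M. r - real k)"
      using M by (intro sum.cong) (auto simp: w_def)
    also have "\<dots> = M * r - real M * (real M - 1) / 2"
      by (induction M) (auto simp: field_simps)
    \<comment> \<open>Completing the square isolates \<open>r\<^sup>2 / 2\<close>; since
      \<open>0 \<le> M - r < 1\<close>, the rest is at most linear in \<open>r\<close>.\<close>
    also have "\<dots> = r\<^sup>2 / 2 + (real M / 2 - (real M - r)\<^sup>2 / 2)"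
      by (simp add: power2_eq_square field_simps)
    finally have sw: "(\<Sum>k<M. w k) = r\<^sup>2 / 2 + (real M / 2 - (real M - r)\<^sup>2 / 2)" .
    have sq1: "(real M - r)\<^sup>2 \<le> real M - r"
      using M mult_left_le[of "real M - r" "real M - r"] by (simp add: power2_eq_square)
    have "M \<ge> 1" using M r by linarith
    have 3: "\<bar>(\<Sum>k<M. w k) - r\<^sup>2 / 2\<bar> \<le> (r + 1) / 2"
    proof -
      define d where "d = (real M - r)\<^sup>2"
      have "0 \<le> d" "d \<le> real M - r" using sq1 by (simp_all add: d_def)
      then show ?thesis unfolding sw d_def[symmetric] using M r by (simp add: abs_le_iff)
    qed
    have "?S r - (1 - \<delta>) / 2 * r\<^sup>2 =
        (\<Sum>k<M. ?e k * w k) + (1 - \<delta>) * ((\<Sum>k<M. w k) - r\<^sup>2 / 2)"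
      unfolding 2 by (simp add: algebra_simps)
    moreover have "\<bar>(1 - \<delta>) * ((\<Sum>k<M. w k) - r\<^sup>2 / 2)\<bar> \<le> 1 * ((r + 1) / 2)"
      unfolding abs_mult using assms 3 by (intro mult_mono) auto
    ultimately have "\<bar>?S r - (1 - \<delta>) / 2 * r\<^sup>2\<bar> \<le> 3 * sqrt (r + 1) * r + (r + 1) / 2"
      using 1 by linarith
    then have "\<bar>?S r - (1 - \<delta>) / 2 * r\<^sup>2\<bar> / r\<^sup>2 \<le> (3 * sqrt (r + 1) * r + (r + 1) / 2) / r\<^sup>2"
      by (rule divide_right_mono) simp
    moreover have "?S r / r\<^sup>2 - (1 - \<delta>) / 2 = (?S r - (1 - \<delta>) / 2 * r\<^sup>2) / r\<^sup>2"
      using r by (simp add: diff_divide_distrib)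
    ultimately show ?thesis by simp
  qed
  have "((\<lambda>r::real. (3 * sqrt (r + 1) * r + (r + 1) / 2) / r\<^sup>2) \<longlongrightarrow> 0) at_top"
    by real_asymp
  then have "((\<lambda>r. ?S r / r\<^sup>2 - (1 - \<delta>) / 2) \<longlongrightarrow> 0) at_top"
    by (rule Lim_null_comparison[rotated])
      (use bound in \<open>auto intro!: eventually_mono[OF eventually_gt_at_top[of 0]]\<close>)
  then show ?thesis
    by (simp add: LIM_zero_cancel)
qed

section \<open>Growth of the characteristic and counting functions, and the resulting defect\<close>

theorem theorem4p2:
  "\<exists>f. tropical_meromorphic f \<and>
    (\<forall>\<delta>::real. \<delta> \<in> {0..1} \<longrightarrow> (\<exists>a::real. trop_defect a f = ereal \<delta>))"
proof (intro exI conjI allI impI)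
  \<comment> \<open>Fixed before \<open>\<delta>\<close>, as one function must serve all
    defects.\<close>
  define h where "h = (\<lambda>k. square_frac k / 3)"
  \<comment> \<open>\<open>R 0\<close> weighs all tents of positive height,
    \<open>R \<delta>\<close> those that survive the cut at level
    \<open>\<delta> / 3\<close>.\<close>
  define R where "R = (\<lambda>d r. \<Sum>k | square_frac k > d \<and> real k < r. r - real k)"
  interpret h: tent_heights h
  proof
    show "h 0 = 0" by (simp add: h_def square_frac_def)
    show "h k \<ge> 0" "h k \<le> 1 / 3" for k
      using square_frac_bounds[of k] by (simp_all add: h_def)
  qed
  show "tropical_meromorphic (tents h)"
    by (rule h.tropical_meromorphic_tents)
  fix \<delta> :: real assume \<delta>: "\<delta> \<in> {0..1}"
  \<comment> \<open>The heights left after the cut, as in \<open>max_tents\<close>; they satisfy the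
    locale again, so its pole count applies to them.\<close>
  define h' where "h' = (\<lambda>k. max 0 (h k - \<delta> / 3))"
  interpret h': tent_heights h'
  proof
    show "h' 0 = 0" using h.h_zero \<delta> by (simp add: h'_def)
    show "h' k \<ge> 0" "h' k \<le> 1 / 3" for k
      using h.h_le[of k] \<delta> unfolding h'_def by (simp, simp add: max_def)
  qed
  define T where "T = (\<lambda>r. trop_characteristic r (tents h))"
  define N where
    "N = (\<lambda>r. trop_counting r (\<lambda>x. 1\<^sub>t \<oslash>\<^sub>t (tents h x \<oplus>\<^sub>t (\<delta> / 3))))"
  \<comment> \<open>Only the right end enters the proximity term, because \<open>tents h\<close>
    vanishes at \<open>- r\<close>.\<close>
  have T_eq: "T r = 1 / 2 * tents h r + R 0 r" if "r > 0" for r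
    using that h.tents_nonneg[of r] h.tents_nonpos[of "- r"] h.trop_counting_tents[of r]
    by (simp add: T_def R_def h_def trop_characteristic_def trop_proximity_def pos_part_def)
  have "(\<lambda>x. 1\<^sub>t \<oslash>\<^sub>t (tents h x \<oplus>\<^sub>t (\<delta> / 3))) = (\<lambda>x. - (\<delta> / 3) - tents h' x)"
    using h.max_tents[of "\<delta> / 3"] \<delta> by (auto simp: trop_one_def trop_divide_def trop_add_def h'_def)
  moreover have "h' k > 0 \<longleftrightarrow> square_frac k > \<delta>" for k
    by (auto simp: h'_def h_def)
  ultimately have N_bound: "\<bar>N r - R \<delta> r\<bar> \<le> r + 2" if "r > 0" for r
    using h'.trop_counting_minus_tents[OF that, of "\<delta> / 3"] by (simp add: N_def R_def)
  have "((\<lambda>r::real. (r + 2) / r\<^sup>2) \<longlongrightarrow> 0) at_top"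
    by real_asymp
  then have "((\<lambda>r. (N r - R \<delta> r) / r\<^sup>2) \<longlongrightarrow> 0) at_top"
    by (rule Lim_null_comparison[rotated])
      (use N_bound in \<open>auto intro!: eventually_mono[OF eventually_gt_at_top[of 0]] divide_right_mono\<close>)
  from tendsto_add[OF this square_frac_riesz_mean[OF \<delta>]]
  have N_lim: "((\<lambda>r. N r / r\<^sup>2) \<longlongrightarrow> (1 - \<delta>) / 2) at_top"
    by (simp add: R_def diff_divide_distrib)
  have "((\<lambda>r. 1 / 2 * tents h r / r\<^sup>2) \<longlongrightarrow> 0) at_top"
  proof (rule Lim_null_comparison)
    show "((\<lambda>r::real. 1 / r\<^sup>2) \<longlongrightarrow> 0) at_top"
      by real_asymp
    have "norm (1 / 2 * tents h r / r\<^sup>2) \<le> 1 / r\<^sup>2" for r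
    proof -
      have "norm (1 / 2 * tents h r / r\<^sup>2) = 1 / 2 * tents h r / r\<^sup>2"
        using h.tents_nonneg[of r] by simp
      also have "\<dots> \<le> 1 / r\<^sup>2"
        using h.tents_le[of r] by (intro divide_right_mono) auto
      finally show ?thesis .
    qed
    then show "\<forall>\<^sub>F r in at_top. norm (1 / 2 * tents h r / r\<^sup>2) \<le> 1 / r\<^sup>2"
      by (rule always_eventually[OF allI])
  qed
  \<comment> \<open>Taking the threshold \<open>0\<close> shows that the tents of height zero, which
    sit over the perfect squares, do not affect the leading term.\<close>
  from tendsto_add[OF this square_frac_riesz_mean[of 0]]
  have "((\<lambda>r. (1 / 2 * tents h r + R 0 r) / r\<^sup>2) \<longlongrightarrow> 1 / 2) at_top"
    by (simp add: R_def add_divide_distrib)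
  then have T_lim: "((\<lambda>r. T r / r\<^sup>2) \<longlongrightarrow> 1 / 2) at_top"
    by (rule Lim_transform_eventually)
      (auto intro!: eventually_mono[OF eventually_gt_at_top[of 0]] simp: T_eq)
  have "((\<lambda>r. (N r / r\<^sup>2) / (T r / r\<^sup>2)) \<longlongrightarrow> (1 - \<delta>) / 2 / (1 / 2)) at_top"
    by (rule tendsto_divide[OF N_lim T_lim]) simp
  moreover have "(1 - \<delta>) / 2 / (1 / 2) = 1 - \<delta>"
    by simp
  ultimately have "((\<lambda>r. (N r / r\<^sup>2) / (T r / r\<^sup>2)) \<longlongrightarrow> 1 - \<delta>) at_top"
    by (simp only:)
  moreover have "\<forall>\<^sub>F r in at_top. (N r / r\<^sup>2) / (T r / r\<^sup>2) = N r / T r"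
    using eventually_gt_at_top[of 0] by eventually_elim simp
  ultimately have "((\<lambda>r. N r / T r) \<longlongrightarrow> 1 - \<delta>) at_top"
    by (rule Lim_transform_eventually)
  then have "Limsup at_top (\<lambda>r. ereal (N r / T r)) = ereal (1 - \<delta>)"
    by (intro lim_imp_Limsup) auto
  then show "trop_defect (\<delta> / 3) (tents h) = ereal \<delta>"
    by (simp add: trop_defect_def N_def T_def one_ereal_def)
qed

end
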